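(* Let $a,c\in\mathbb{R}$ with $a<c$, and let $f:[a,c]\to\mathbb{R}$ be a function such that $c$ is the unique root of $f$ in $[a,c]$. Assume that $f'(x)$ and $f''(x)$ exist for each $x\in(a,c)$, that the right derivative $f'(a+)$ of $f$ at $a$ and the left derivative $f'(c-)$ of $f$ at $c$ exist, and that: (i) $f(x)f''(x)\ge 0$ for each $x\in(a,c)$; (ii) $f(x)f'(x)<0$ for each $x\in[a,c)$; (iii) $f'(x)\neq 0$ for each $x\in(a,c)$, $f'(a+)\neq 0$ and $f'(c-)\neq 0$. For any $x_0\in[a,c]$ define $$x_{n+1}=x_n-\frac{f(x_n)}{f'(x_n)}\quad\text{for all } n\ge 0.$$ Then the sequence $\{x_n\}$ converges to $c$ as $n\to\infty$.
   Context: $f'(a+)$ and $f'(c-)$ denote the (finite) one-sided derivatives of $f$ at the endpoints: the right derivative at $a$ and the left derivative at $c$. Since $f$ is defined only on $[a,c]$, at the endpoints the symbol $f'$ means the corresponding one-sided derivative: $f'(a)=f'(a+)$ and $f'(c)=f'(c-)$ (in hypothesis (ii) and in the recursion). The conclusion includes that the recursion is well defined, i.e. all $x_n$ lie in $[a,c]$. *)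

theory Defs
  imports Complex_Main
begin

end

theory Submission
  imports Defs
begin

text \<open>Up to replacing \<open>f\<close> by \<open>-f\<close>, which does not change the iteration, \<open>f\<close> is positive on
  \<open>[a,c)\<close>, hence convex and decreasing. Convexity puts the graph above its tangents, so a Newton
  step started in \<open>[a,c)\<close> moves right without passing \<open>c\<close>. The iterates thus increase to a limit
  \<open>L > a\<close>; if \<open>L < c\<close>, then \<open>f\<close> and \<open>f'\<close> are continuous at \<open>L\<close>, and passing to the limit in the
  recursion makes \<open>L\<close> a root.\<close>

text \<open>The chord slope over \<open>{t..c}\<close> is \<open>f' z\<close> for some interior
  \<open>z\<close>, so \<open>f' t \<le> f' z\<close> suffices. Only a right derivative is asked for
  at \<open>t\<close>, so that the left endpoint of the Newton interval is covered.\<close>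

lemma right_tangent_le:
  fixes f f' :: "real \<Rightarrow> real"
  assumes "t < c" and cont: "continuous_on {t..c} f"
    and deriv: "\<And>s. s \<in> {t<..<c} \<Longrightarrow> (f has_real_derivative f' s) (at s)"
    and right: "(f has_real_derivative f' t) (at_right t)"
    and mono: "mono_on {t<..<c} f'"
  shows "f t + f' t * (c - t) \<le> f c"
proof -
  have mvt: "\<exists>z. t < z \<and> z < u \<and> f u - f t = (u - t) * f' z" if "t < u" "u \<le> c" for u
  proof (rule mvt[of t u f "\<lambda>s h. f' s * h"])
    show "t < u" by fact
    show "continuous_on {t..u} f"
      using cont that by (auto intro: continuous_on_subset)
    show "(f has_derivative (\<lambda>h. f' s * h)) (at s)" if "t < s" "s < u" for s
      using deriv[of s] that \<open>u \<le> c\<close> by (auto simp: has_field_derivative_def)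
  qed (auto simp: mult.commute)
  obtain z where z: "t < z" "z < c" "f c - f t = (c - t) * f' z"
    using mvt[of c] \<open>t < c\<close> by auto
  \<comment> \<open>Monotonicity of \<open>f'\<close> is given only to the right of
    \<open>t\<close>, so \<open>f' t\<close> is compared with \<open>f' z\<close> as a limit of
    difference quotients. For \<open>s < z\<close> each of these is a value of \<open>f'\<close> to
    the left of \<open>z\<close>.\<close>
  have "((\<lambda>s. (f s - f t) / (s - t)) \<longlongrightarrow> f' t) (at_right t)"
    using right by (simp add: has_field_derivative_iff)
  moreover have "\<forall>\<^sub>F s in at_right t. (f s - f t) / (s - t) \<le> f' z"
    using eventually_at_right_real[OF z(1)]
  proof eventually_elim
    case (elim s)
    then obtain y where y: "t < y" "y < s" "f s - f t = (s - t) * f' y"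
      using mvt[of s] z(2) by auto
    moreover have "f' y \<le> f' z"
      using elim y z by (intro mono_onD[OF mono]) auto
    ultimately show ?case
      by simp
  qed
  ultimately have "f' t \<le> f' z"
    by (rule tendsto_upperbound) simp
  then have "f' t * (c - t) \<le> f' z * (c - t)"
    using \<open>t < c\<close> by (intro mult_right_mono) auto
  then show ?thesis
    using z(3) by (simp add: mult.commute)
qed

lemma newton_tendsto_positive:
  fixes a c :: real and f f' f'' :: "real \<Rightarrow> real" and x :: "nat \<Rightarrow> real"
  assumes "a < c" and fc: "f c = 0"
    and deriv: "\<And>t. t \<in> {a<..<c} \<Longrightarrow> (f has_real_derivative f' t) (at t)"
    and deriv2: "\<And>t. t \<in> {a<..<c} \<Longrightarrow> (f' has_real_derivative f'' t) (at t)"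
    and right: "(f has_real_derivative f' a) (at_right a)"
    and cont: "continuous_on {a..c} f"
    and f_pos: "\<And>t. t \<in> {a..<c} \<Longrightarrow> f t > 0"
    and f'_neg: "\<And>t. t \<in> {a..<c} \<Longrightarrow> f' t < 0"
    and f''_nonneg: "\<And>t. t \<in> {a<..<c} \<Longrightarrow> f'' t \<ge> 0"
    and x0: "x 0 \<in> {a..c}"
    and x_Suc: "\<And>n. x (Suc n) = x n - f (x n) / f' (x n)"
  shows "(\<forall>n. x n \<in> {a..c}) \<and> x \<longlonglongrightarrow> c"
proof -
  have f'_mono: "mono_on {a<..<c} f'"
  proof (rule mono_onI)
    fix r s assume rs: "r \<in> {a<..<c}" "s \<in> {a<..<c}" "r \<le> s"
    show "f' r \<le> f' s"
    proof (rule DERIV_nonneg_imp_nondecreasing[OF rs(3)])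
      fix t assume "r \<le> t" "t \<le> s"
      with rs have "t \<in> {a<..<c}" by auto
      then show "\<exists>y. (f' has_real_derivative y) (at t) \<and> 0 \<le> y"
        using deriv2 f''_nonneg by blast
    qed
  qed
  \<comment> \<open>Since \<open>f c = 0\<close>, dividing the tangent inequality by
    \<open>f' t < 0\<close> gives the upper bound; the strict increase is just
    \<open>f t / f' t < 0\<close>.\<close>
  have step: "t < t - f t / f' t \<and> t - f t / f' t \<le> c" if t: "t \<in> {a..<c}" for t
  proof -
    have "f t + f' t * (c - t) \<le> f c"
    proof (rule right_tangent_le)
      show "continuous_on {t..c} f"
        using t by (intro continuous_on_subset[OF cont]) auto
      show "(f has_real_derivative f' t) (at_right t)"
        using t right deriv[of t] by (cases "t = a") (auto intro: has_field_derivative_at_within)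
      show "mono_on {t<..<c} f'"
        using t by (intro mono_on_subset[OF f'_mono]) auto
    qed (use t deriv in auto)
    then show ?thesis
      using f_pos[OF t] f'_neg[OF t] fc by (auto simp: field_simps)
  qed
  \<comment> \<open>At \<open>x n = c\<close> the recursion is stationary because
    \<open>f c = 0\<close>.\<close>
  have stay: "x (Suc n) \<in> {a..c} \<and> x n \<le> x (Suc n)" if "x n \<in> {a..c}" for n
    using that step[of "x n"] fc x_Suc[of n] by (cases "x n = c") auto
  have range: "x n \<in> {a..c}" for n
    by (induction n) (use x0 stay in auto)
  have "incseq x"
    using stay range by (intro incseq_SucI) auto
  moreover have "\<forall>i. x i \<le> c"
    using range by auto
  ultimately obtain L where L: "x \<longlonglongrightarrow> L" "\<forall>i. x i \<le> L"
    by (rule incseq_convergent)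
  have "L \<le> c"
    using L(1) by (rule LIMSEQ_le_const2) (use range in auto)
  have "\<not> L < c"
  proof
    assume "L < c"
    \<comment> \<open>The first step is strict, so \<open>L > a\<close> even when
      \<open>x 0 = a\<close>. This matters because \<open>f'\<close> is known to be continuous only
      inside the open interval.\<close>
    have "x 0 < c"
      using L(2) \<open>L < c\<close> by (meson le_less_trans)
    then have "x 0 < x 1"
      using step[of "x 0"] x0 x_Suc[of 0] by simp
    then have inner: "L \<in> {a<..<c}"
      using spec[OF L(2), of 1] \<open>L < c\<close> x0 by simp
    then have "f' L \<noteq> 0"
      using f'_neg[of L] by auto
    have "(\<lambda>n. x n - f (x n) / f' (x n)) \<longlonglongrightarrow> L - f L / f' L"
      by (intro tendsto_intros L(1) \<open>f' L \<noteq> 0\<close> isCont_tendsto_compose[OF _ L(1)]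
          DERIV_isCont[OF deriv[OF inner]] DERIV_isCont[OF deriv2[OF inner]])
    moreover have "(\<lambda>n. x n - f (x n) / f' (x n)) \<longlonglongrightarrow> L"
      using LIMSEQ_Suc[OF L(1)] by (simp add: x_Suc)
    ultimately have "L - f L / f' L = L"
      by (rule LIMSEQ_unique)
    then show False
      using f_pos[of L] inner \<open>f' L \<noteq> 0\<close> by auto
  qed
  with \<open>L \<le> c\<close> L(1) range show ?thesis
    by (auto simp: order.order_iff_strict)
qed

theorem theorem2p1:
  fixes a c :: real and f f' f'' :: "real \<Rightarrow> real" and x :: "nat \<Rightarrow> real"
  assumes "a < c"
    and "f c = 0"
    and "\<And>t. t \<in> {a..c} \<Longrightarrow> f t = 0 \<Longrightarrow> t = c"
    and "\<And>t. t \<in> {a<..<c} \<Longrightarrow> (f has_real_derivative f' t) (at t)"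
    and "\<And>t. t \<in> {a<..<c} \<Longrightarrow> (f' has_real_derivative f'' t) (at t)"
    and "(f has_real_derivative f' a) (at_right a)"
    and "(f has_real_derivative f' c) (at_left c)"
    and "\<And>t. t \<in> {a<..<c} \<Longrightarrow> f t * f'' t \<ge> 0"
    and "\<And>t. t \<in> {a..<c} \<Longrightarrow> f t * f' t < 0"
    and "\<And>t. t \<in> {a<..<c} \<Longrightarrow> f' t \<noteq> 0"
    and "f' a \<noteq> 0"
    and "f' c \<noteq> 0"
    and "x 0 \<in> {a..c}"
    and "\<And>n. x (Suc n) = x n - f (x n) / f' (x n)"
  shows "(\<forall>n. x n \<in> {a..c}) \<and> x \<longlonglongrightarrow> c"
proof -
  \<comment> \<open>At the endpoints, continuity within \<open>{a..c}\<close> is one-sided and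
    follows from the one-sided derivatives.\<close>
  have cont: "continuous_on {a..c} f"
    unfolding continuous_on_eq_continuous_within
  proof
    fix t assume "t \<in> {a..c}"
    then consider "t = a" | "t = c" | "t \<in> {a<..<c}" by force
    then show "continuous (at t within {a..c}) f"
    proof cases
      case 1
      then show ?thesis
        using DERIV_continuous[OF assms(6)] \<open>a < c\<close> by (simp add: at_within_Icc_at_right)
    next
      case 2
      then show ?thesis
        using DERIV_continuous[OF assms(7)] \<open>a < c\<close> by (simp add: at_within_Icc_at_left)
    next
      case 3
      then show ?thesis
        by (rule continuous_at_imp_continuous_at_within[OF DERIV_isCont[OF assms(4)]])
    qed
  qed
  have "f a \<noteq> 0"
    using assms(3)[of a] \<open>a < c\<close> by auto
  \<comment> \<open>A sign change between \<open>a\<close> and \<open>t\<close> would give a root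
    before \<open>c\<close> by the intermediate value theorem, in its rising or falling
    form.\<close>
  have sign: "f t * f a > 0" if t: "t \<in> {a..<c}" for t
  proof (rule ccontr)
    assume "\<not> f t * f a > 0"
    then have "f a \<le> 0 \<and> 0 \<le> f t \<or> f t \<le> 0 \<and> 0 \<le> f a"
      by (auto simp: zero_less_mult_iff)
    moreover have "continuous_on {a..t} f"
      using t by (intro continuous_on_subset[OF cont]) auto
    ultimately obtain s where "a \<le> s" "s \<le> t" "f s = 0"
      using IVT'[of f a 0 t] IVT2'[of f t 0 a] t by auto
    then show False
      using assms(3)[of s] t by auto
  qed
  show ?thesis
  proof (cases "f a > 0")
    case True
    then have pos: "f t > 0" if "t \<in> {a..<c}" for t
      using sign[OF that] by (simp add: zero_less_mult_iff)
    show ?thesis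
    proof (rule newton_tendsto_positive)
      show "f' t < 0" if "t \<in> {a..<c}" for t
        using assms(9)[OF that] pos[OF that] by (simp add: mult_less_0_iff)
      show "f'' t \<ge> 0" if "t \<in> {a<..<c}" for t
        using assms(8)[OF that] pos[of t] that by (simp add: zero_le_mult_iff)
    qed (use assms(1,2,4-6,13,14) cont pos in auto)
  next
    case False
    with \<open>f a \<noteq> 0\<close> have neg: "f t < 0" if "t \<in> {a..<c}" for t
      using sign[OF that] by (simp add: zero_less_mult_iff)
    show ?thesis
    proof (rule newton_tendsto_positive)
      \<comment> \<open>The conclusion does not mention the function, so this line fixes the
        instance with \<open>f\<close> and \<open>f'\<close> negated. The signs cancel in the
        quotient, so \<open>x\<close> satisfies the same recursion.\<close>
      show "((\<lambda>t. - f t) has_real_derivative - f' t) (at t)" if "t \<in> {a<..<c}" for t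
        using assms(4)[OF that] by (rule DERIV_minus)
      show "((\<lambda>t. - f' t) has_real_derivative - f'' t) (at t)" if "t \<in> {a<..<c}" for t
        using assms(5)[OF that] by (rule DERIV_minus)
      show "((\<lambda>t. - f t) has_real_derivative - f' a) (at_right a)"
        using assms(6) by (rule DERIV_minus)
      show "continuous_on {a..c} (\<lambda>t. - f t)"
        using cont by (rule continuous_on_minus)
      show "- f' t < 0" if "t \<in> {a..<c}" for t
        using assms(9)[OF that] neg[OF that] by (simp add: mult_less_0_iff)
      show "- f'' t \<ge> 0" if "t \<in> {a<..<c}" for t
        using assms(8)[OF that] neg[of t] that by (simp add: zero_le_mult_iff)
    qed (use assms(1,2,13,14) neg in auto)
  qed
qed

end
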